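(* Let $C\subseteq\mathbb R^d$ be a closed salient convex cone with nonempty interior. Then for any linear hyperplane $H\subseteq\mathbb R^d$ with $H\cap C=\{0\}$, there is an order unit $u\in C$ (i.e. $u\in{\rm int}(C)$) such that, with $\nu=1/(d+1)$ and the scaled cone $\nu\!\uparrow\! C$ formed with respect to $H$ and $u$, the inclusion $(\nu\!\uparrow\! C)^{\max}\subseteq C^{\min}$ holds, i.e. $(\nu\!\uparrow\! C)^{\max}_s\subseteq C^{\min}_s$ for all $s\ge1$.
   Context: ${\rm Her}_s(\mathbb C)$ denotes the Hermitian $s\times s$ matrices; $\geqslant 0$ denotes positive semidefiniteness. A convex cone $C$ is salient if $C\cap(-C)=\{0\}$. For $c\in\mathbb R^d$ and $P\in{\rm Her}_s(\mathbb C)$, $c\otimes P:=(c_1P,\ldots,c_dP)$. For a closed salient convex cone $C\subseteq\mathbb R^d$ with nonempty interior and $s\ge1$, $$C_s^{\min}:=\Big\{\sum_i c_i\otimes P_i\ \text{(finite sums)}\ \Big|\ c_i\in C,\ P_i\in{\rm Her}_s(\mathbb C),\ P_i\geqslant0\Big\},$$ $$C_s^{\max}:=\{(A_1,\ldots,A_d)\in{\rm Her}_s(\mathbb C)^d\mid (v^*A_1v,\ldots,v^*A_dv)\in C\ \text{ for all } v\in\mathbb C^s\}.$$ Given a linear hyperplane $H$ with $H\cap C=\{0\}$, an order unit $u\in{\rm int}(C)$, and $\nu>0$, the scaled cone $\nu\!\uparrow\! C$ is the conical hull (including the origin) of $\{u+\nu(x-u)\mid x\in C\cap(u+H)\}$,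 i.e. of the set obtained by scaling $C\cap(u+H)$ by the factor $\nu$ from the point $u$. *)

theory Defs
  imports "Jordan_Normal_Form.Schur_Decomposition" "HOL-Analysis.Analysis"
begin

text \<open>
  Vectors in \<open>\<real>\<^sup>d\<close> are of type \<open>real^'d\<close>. The size \<open>s\<close> of the Hermitian matrices is quantified
  inside the formulas (after the choice of an order unit), so complex matrices and vectors are
  those of \<open>Jordan_Normal_Form\<close>, with explicit carriers. An element of \<open>Her\<^sub>s(\<complex>)\<^sup>d\<close> is a function
  from the index type \<open>'d\<close> to matrices.

  Both libraries use the infix dollar sign; components of \<open>real^'d\<close> are therefore written \<open>$h\<close>.
\<close>

notation vec_nth (infixl "$h" 90)

definition salient :: "(real^'d) set \<Rightarrow> bool" where
  "salient C \<longleftrightarrow> C \<inter> uminus ` C = {0}"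

definition Her :: "nat \<Rightarrow> complex mat set" where
  "Her s = {A \<in> carrier_mat s s. mat_adjoint A = A}"

text \<open>The value \<open>v\<^sup>*Av\<close>: the product \<open>w \<bullet>c v\<close> conjugates its second argument.\<close>

definition quad_form :: "complex mat \<Rightarrow> complex Matrix.vec \<Rightarrow> complex" where
  "quad_form A v = (A *\<^sub>v v) \<bullet>c v"

text \<open>On \<open>complex\<close>, the order \<open>0 \<le> z\<close> means that \<open>z\<close> is real and nonnegative.\<close>

definition PSD :: "nat \<Rightarrow> complex mat set" where
  "PSD s = {P \<in> Her s. \<forall>v \<in> carrier_vec s. 0 \<le> quad_form P v}"

definition tensor :: "real^'d \<Rightarrow> complex mat \<Rightarrow> 'd \<Rightarrow> complex mat" where
  "tensor c P = (\<lambda>i. complex_of_real (c $h i) \<cdot>\<^sub>m P)"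

text \<open>
  Type \<open>complex mat\<close> contains matrices of all sizes and hence is not a commutative monoid, so
  sums of \<open>d\<close>-tuples of \<open>s \<times> s\<close> matrices are taken entrywise.
\<close>

definition tuple_sum :: "nat \<Rightarrow> nat \<Rightarrow> (nat \<Rightarrow> 'd \<Rightarrow> complex mat) \<Rightarrow> 'd \<Rightarrow> complex mat" where
  "tuple_sum s n T = (\<lambda>i. Matrix.mat s s (\<lambda>(a, b). \<Sum>k<n. T k i $$ (a, b)))"

definition cone_min :: "(real^'d) set \<Rightarrow> nat \<Rightarrow> ('d \<Rightarrow> complex mat) set" where
  "cone_min C s =
     {tuple_sum s n (\<lambda>k. tensor (c k) (P k)) | n c P. \<forall>k<n. c k \<in> C \<and> P k \<in> PSD s}"

text \<open>
  For Hermitian \<open>A i\<close> the number \<open>v\<^sup>*(A i)v\<close> is real; \<open>Re\<close> merely converts it to type \<open>real\<close>.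
\<close>

definition cone_max :: "(real^'d) set \<Rightarrow> nat \<Rightarrow> ('d \<Rightarrow> complex mat) set" where
  "cone_max C s =
     {A. (\<forall>i. A i \<in> Her s) \<and> (\<forall>v \<in> carrier_vec s. (\<chi> i. Re (quad_form (A i) v)) \<in> C)}"

text \<open>A set that satisfies \<open>convex_cone\<close> is nonempty, so the hull always contains the origin.\<close>

definition scaled_cone :: "real \<Rightarrow> (real^'d) set \<Rightarrow> real^'d \<Rightarrow> (real^'d) set \<Rightarrow> (real^'d) set" where
  "scaled_cone \<nu> H u C = convex_cone hull ((\<lambda>x. u + \<nu> *\<^sub>R (x - u)) ` (C \<inter> (+) u ` H))"

end

theory Submission
  imports Defs
begin

text \<open>
  Among all simplices with vertices in the base \<open>C \<inter> {x. a \<bullet> x = 1}\<close>, where \<open>a\<close> is normal to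
  \<open>H\<close>, take one of maximal volume. By Cramer's rule, maximality says that every point of the base
  has coordinates in \<open>[-1, 1]\<close> with respect to the vertices. Let \<open>u\<close> be the barycenter, with
  coordinates \<open>1/d\<close>. Scaling by \<open>1/(d+1)\<close> from \<open>u\<close> moves a coordinate \<open>t\<close> to
  \<open>(1 + t)/(d + 1) \<ge> 0\<close>, so the scaled cone lies in the cone over the simplex, and for
  simplicial cones the maximal and minimal systems coincide.
\<close>

section \<open>Quadratic forms of Hermitian matrices\<close>

lemma quad_form_sum:
  assumes "A \<in> carrier_mat s s" "v \<in> carrier_vec s"
  shows "quad_form A v = (\<Sum>a<s. (\<Sum>b<s. A $$ (a, b) * vec_index v b) * cnj (vec_index v a))"
  using assms
  by (auto simp: quad_form_def Matrix.scalar_prod_def row_def carrier_matD lessThan_atLeast0 intro!: sum.cong)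

lemma Her_iff:
  "A \<in> Her s \<longleftrightarrow> A \<in> carrier_mat s s \<and> (\<forall>a<s. \<forall>b<s. cnj (A $$ (a, b)) = A $$ (b, a))"
proof (cases "A \<in> carrier_mat s s")
  case True
  have *: "mat_adjoint A = Matrix.mat s s (\<lambda>(a, b). cnj (A $$ (b, a)))"
    using True by (intro eq_matI) (auto simp: mat_adjoint_def mat_of_rows_def)
  have "A \<in> Her s \<longleftrightarrow> mat_adjoint A = A"
    using True by (simp add: Her_def)
  also have "\<dots> \<longleftrightarrow> (\<forall>a<s. \<forall>b<s. cnj (A $$ (b, a)) = A $$ (a, b))"
    unfolding * using True by (auto simp: mat_eq_iff)
  finally show ?thesis
    using True by blast
qed (auto simp: Her_def)

text \<open>For Hermitian \<open>A\<close>, conjugation exchanges the two summation indices, so the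
  value is its own conjugate.\<close>

lemma Im_quad_form_Her:
  assumes "A \<in> Her s" "v \<in> carrier_vec s"
  shows "Im (quad_form A v) = 0"
proof -
  have A: "A \<in> carrier_mat s s" "\<And>a b. a < s \<Longrightarrow> b < s \<Longrightarrow> cnj (A $$ (a, b)) = A $$ (b, a)"
    using assms(1) unfolding Her_iff by auto
  have "cnj (quad_form A v)
      = (\<Sum>a<s. \<Sum>b<s. cnj (A $$ (a, b)) * cnj (vec_index v b) * vec_index v a)"
    by (simp add: quad_form_sum[OF A(1) assms(2)] sum_distrib_right)
  also have "\<dots> = (\<Sum>a<s. \<Sum>b<s. A $$ (b, a) * vec_index v a * cnj (vec_index v b))"
    using A(2) by (intro sum.cong) (auto simp: ac_simps)
  also have "\<dots> = quad_form A v"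
    unfolding quad_form_sum[OF A(1) assms(2)] sum_distrib_right by (rule sum.swap)
  finally show ?thesis
    by (simp add: complex_eq_iff)
qed

text \<open>Links the complex order in \<open>PSD\<close> with the real parts that occur in
  \<open>cone_max\<close>.\<close>

lemma PSD_iff:
  "P \<in> PSD s \<longleftrightarrow> P \<in> Her s \<and> (\<forall>v \<in> carrier_vec s. 0 \<le> Re (quad_form P v))"
  unfolding PSD_def using Im_quad_form_Her by (auto simp: less_eq_complex_def)

section \<open>Maximal and minimal systems over simplicial cones\<close>

lemma cone_max_mono: "C \<subseteq> D \<Longrightarrow> cone_max C s \<subseteq> cone_max D s"
  by (auto simp: cone_max_def)

lemma convex_cone_sum:
  assumes "convex_cone C" "\<And>i. i \<in> I \<Longrightarrow> x i \<in> C"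
  shows "sum x I \<in> C"
  using assms(2)
  by (induction I rule: infinite_finite_induct)
    (auto simp: convex_cone_contains_0[OF assms(1)] intro: convex_cone_add[OF assms(1)])

lemma vector_matrix_mult_rows:
  fixes x :: "real^'n" and V :: "real^'m^'n"
  shows "x v* V = (\<Sum>i\<in>UNIV. x $h i *\<^sub>R V $h i)"
  by (simp add: vec_eq_iff vector_matrix_mult_def mult.commute)

text \<open>As \<open>W\<close> inverts \<open>V\<close>, the entries of \<open>x v* W\<close> are
  the coordinates of \<open>x\<close> in the basis of rows of \<open>V\<close>. The set on the left
  is thus the cone generated by these rows.\<close>

lemma simplicial_cone_subset:
  fixes V W :: "real^'d^'d"
  assumes "convex_cone C" "\<And>i. V $h i \<in> C" "W ** V = Finite_Cartesian_Product.mat 1"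
  shows "{x. \<forall>i. 0 \<le> (x v* W) $h i} \<subseteq> C"
proof
  fix x assume x: "x \<in> {x. \<forall>i. 0 \<le> (x v* W) $h i}"
  have "x = (x v* W) v* V"
    by (simp add: vector_matrix_mul_assoc assms(3))
  also have "\<dots> \<in> C"
    unfolding vector_matrix_mult_rows[of "x v* W"]
    using x by (intro convex_cone_sum convex_cone_scaleR assms) (simp_all only: mem_Collect_eq)
  finally show "x \<in> C" .
qed

text \<open>
  Over a simplicial cone a tuple is positive as soon as its coordinates \<open>P i\<close> in the basis of
  extreme rays are, and then the expansion in that basis is a decomposition into tensors.
\<close>

lemma cone_max_simplicial_cone_subset:
  fixes V W :: "real^'d^'d"
  assumes "\<And>i. V $h i \<in> C" "W ** V = Finite_Cartesian_Product.mat 1"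
  shows "cone_max {x. \<forall>i. 0 \<le> (x v* W) $h i} s \<subseteq> cone_min C s"
proof
  fix A assume "A \<in> cone_max {x. \<forall>i. 0 \<le> (x v* W) $h i} s"
  then have AH: "\<And>j. A j \<in> Her s"
    and Aq: "\<And>v i. v \<in> carrier_vec s \<Longrightarrow>
      0 \<le> (\<Sum>j\<in>UNIV. W $h j $h i * Re (quad_form (A j) v))"
    by (auto simp: cone_max_def vector_matrix_mult_def mult.commute)
  have Ac: "\<And>j. A j \<in> carrier_mat s s"
    and Ah: "\<And>j a b. a < s \<Longrightarrow> b < s \<Longrightarrow> cnj (A j $$ (a, b)) = A j $$ (b, a)"
    using AH unfolding Her_iff by blast+
  \<comment> \<open>The matrix analogue of \<open>x v* W\<close>: \<open>P i\<close> is the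
    coordinate of the tuple \<open>A\<close> at row \<open>i\<close> of \<open>V\<close>.\<close>
  define P where
    "P i = Matrix.mat s s (\<lambda>(a, b). \<Sum>j\<in>UNIV. complex_of_real (W $h j $h i) * A j $$ (a, b))" for i
  have Pc: "P i \<in> carrier_mat s s" for i
    by (simp add: P_def)
  \<comment> \<open>The quadratic form is linear in the matrix, so its value at \<open>P i\<close>
    is the coordinate that \<open>Aq\<close> shows to be nonnegative.\<close>
  have quad: "quad_form (P i) v = (\<Sum>j\<in>UNIV. complex_of_real (W $h j $h i) * quad_form (A j) v)"
    if v: "v \<in> carrier_vec s" for i v
  proof -
    have "quad_form (P i) v = (\<Sum>a<s. \<Sum>b<s. \<Sum>j\<in>UNIV.
        complex_of_real (W $h j $h i) * (A j $$ (a, b) * vec_index v b * cnj (vec_index v a)))"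
      unfolding quad_form_sum[OF Pc v] by (simp add: P_def sum_distrib_right mult.assoc)
    also have "\<dots> = (\<Sum>a<s. \<Sum>j\<in>UNIV. \<Sum>b<s.
        complex_of_real (W $h j $h i) * (A j $$ (a, b) * vec_index v b * cnj (vec_index v a)))"
      by (intro sum.cong refl sum.swap)
    also have "\<dots> = (\<Sum>j\<in>UNIV. \<Sum>a<s. \<Sum>b<s.
        complex_of_real (W $h j $h i) * (A j $$ (a, b) * vec_index v b * cnj (vec_index v a)))"
      by (rule sum.swap)
    also have "\<dots> = (\<Sum>j\<in>UNIV. complex_of_real (W $h j $h i) * quad_form (A j) v)"
      by (simp add: quad_form_sum[OF Ac v] sum_distrib_left sum_distrib_right)
    finally show ?thesis .
  qed
  have "P i \<in> Her s" for i
    unfolding Her_iff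
  proof (intro conjI Pc allI impI)
    fix a b assume "a < s" "b < s"
    then show "cnj (P i $$ (a, b)) = P i $$ (b, a)"
      using Ah by (simp add: P_def)
  qed
  then have PSD: "P i \<in> PSD s" for i
    unfolding PSD_iff using Aq by (auto simp: quad)
  \<comment> \<open>Multiplying the coordinates by \<open>V\<close> recovers \<open>A\<close>, since
    \<open>W ** V\<close> is the identity.\<close>
  have expand: "A k $$ (a, b) = (\<Sum>i\<in>UNIV. complex_of_real (V $h i $h k) * P i $$ (a, b))"
    if ab: "a < s" "b < s" for k a b
  proof -
    have WV: "(\<Sum>i\<in>UNIV. W $h j $h i * V $h i $h k) = (if j = k then 1 else 0)" for j
      using arg_cong[OF assms(2), of "\<lambda>M. M $h j $h k"]
      by (simp add: matrix_matrix_mult_def Finite_Cartesian_Product.mat_def)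
    have "(\<Sum>i\<in>UNIV. complex_of_real (V $h i $h k) * P i $$ (a, b))
        = (\<Sum>i\<in>UNIV. \<Sum>j\<in>UNIV. complex_of_real (W $h j $h i * V $h i $h k) * A j $$ (a, b))"
      using ab by (simp add: P_def sum_distrib_left ac_simps)
    also have "\<dots> = (\<Sum>j\<in>UNIV. complex_of_real (\<Sum>i\<in>UNIV. W $h j $h i * V $h i $h k) * A j $$ (a, b))"
      unfolding of_real_sum sum_distrib_right by (rule sum.swap)
    also have "\<dots> = (\<Sum>j\<in>UNIV. if j = k then A j $$ (a, b) else 0)"
      unfolding WV by (intro sum.cong) auto
    finally show ?thesis
      by simp
  qed
  \<comment> \<open>\<open>tuple_sum\<close> runs over natural numbers, the rows of \<open>V\<close>
    over \<open>'d\<close>; \<open>h\<close> translates.\<close>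
  obtain h :: "nat \<Rightarrow> 'd" where h: "bij_betw h {..<CARD('d)} UNIV"
    using ex_bij_betw_nat_finite[of "UNIV :: 'd set"] by (auto simp: lessThan_atLeast0)
  have "A = tuple_sum s CARD('d) (\<lambda>k. tensor (V $h h k) (P (h k)))"
  proof
    fix k
    have "A k $$ (a, b) = (\<Sum>i<CARD('d). complex_of_real (V $h h i $h k) * P (h i) $$ (a, b))"
      if "a < s" "b < s" for a b
      unfolding expand[OF that] by (rule sum.reindex_bij_betw[OF h, symmetric])
    then show "A k = tuple_sum s CARD('d) (\<lambda>k. tensor (V $h h k) (P (h k))) k"
      using Ac[of k]
      by (intro eq_matI) (auto simp: tuple_sum_def tensor_def carrier_matD[OF Pc] intro!: sum.cong)
  qed
  then show "A \<in> cone_min C s"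
    unfolding cone_min_def mem_Collect_eq
    using assms(1) PSD
    by (intro exI[of _ "CARD('d)"] exI[of _ "\<lambda>k. V $h h k"] exI[of _ "\<lambda>k. P (h k)"]) auto
qed

section \<open>Compact bases of salient cones\<close>

text \<open>If \<open>inner a\<close> took both signs on \<open>C\<close>, a positive combination of
  two such points would have value 0 and hence vanish. Then \<open>C\<close> would contain a nonzero
  vector and its negative, against salience.\<close>

lemma strictly_positive_on_cone:
  fixes C :: "'a::euclidean_space set"
  assumes "convex_cone C" "C \<inter> uminus ` C = {0}" "\<And>x. x \<in> C \<Longrightarrow> inner a x = 0 \<Longrightarrow> x = 0"
  obtains b where "b = a \<or> b = - a" "\<And>x. x \<in> C \<Longrightarrow> x \<noteq> 0 \<Longrightarrow> 0 < inner b x"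
proof -
  have False if xy: "x \<in> C" "y \<in> C" "inner a x > 0" "inner a y < 0" for x y
  proof -
    let ?x = "(- inner a y) *\<^sub>R x" and ?y = "inner a x *\<^sub>R y"
    have mem: "?x \<in> C" "?y \<in> C"
      using xy by (simp_all only: convex_cone_scaleR[OF assms(1)] neg_0_le_iff_le less_imp_le)
    have "?x + ?y = 0"
      by (rule assms(3)[OF convex_cone_add[OF assms(1) mem]]) (simp add: inner_simps)
    then have "?y \<in> C \<inter> uminus ` C"
      using mem by (auto simp: image_iff add_eq_0_iff intro!: bexI[of _ ?x])
    then have "?y = 0"
      using assms(2) by blast
    then show False
      using xy by auto
  qed
  then consider "\<forall>x\<in>C. inner a x \<ge> 0" | "\<forall>x\<in>C. inner a x \<le> 0"
    by (meson linorder_not_le)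
  then show ?thesis
  proof cases
    case 1
    then show ?thesis
      using that[of a] assms(3) by (metis order_le_less)
  next
    case 2
    then show ?thesis
      using that[of "- a"] assms(3) by (metis inner_minus_left neg_0_less_iff_less order_le_less)
  qed
qed

text \<open>By homogeneity, the norms on the base are bounded by the reciprocal of the minimum of
  \<open>inner a\<close> over the unit vectors of \<open>C\<close>, which is positive.\<close>

lemma compact_cone_base:
  fixes C :: "'a::euclidean_space set"
  assumes "closed C" "convex_cone C" "\<And>x. x \<in> C \<Longrightarrow> x \<noteq> 0 \<Longrightarrow> 0 < inner a x"
  shows "compact {x \<in> C. inner a x = 1}"
proof -
  have "closed {x \<in> C. inner a x = 1}"
    using closed_Int[OF assms(1) closed_hyperplane[of a 1]] by (simp add: Int_def)
  moreover have "bounded {x \<in> C. inner a x = 1}"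
  \<comment> \<open>The minimum exists only if \<open>C\<close> has unit vectors; otherwise
    \<open>C\<close> contains no nonzero point.\<close>
  proof (cases "C \<inter> sphere 0 1 = {}")
    case True
    have "x = 0" if "x \<in> C" for x
      using True convex_cone_scaleR[OF assms(2) _ that, of "1 / norm x"]
      by (cases "x = 0") (auto simp: disjoint_iff)
    then show ?thesis
      by (intro bounded_subset[OF bounded_insert[THEN iffD2, OF bounded_empty], of _ 0]) auto
  next
    case False
    have "compact (C \<inter> sphere 0 1)"
      using assms(1) by (simp add: closed_Int_compact)
    moreover have "continuous_on (C \<inter> sphere 0 1) (inner a)"
      by (intro continuous_intros)
    ultimately obtain m where m: "m \<in> C \<inter> sphere 0 1"
      and min: "\<And>y. y \<in> C \<inter> sphere 0 1 \<Longrightarrow> inner a m \<le> inner a y"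
      using continuous_attains_inf[OF _ False] by blast
    have pos: "0 < inner a m"
      using m assms(3)[of m] by (cases "m = 0") auto
    have "norm x \<le> 1 / inner a m" if x: "x \<in> C" "inner a x = 1" for x
    proof -
      have "x \<noteq> 0"
        using x by auto
      then have "inner a m \<le> inner a ((1 / norm x) *\<^sub>R x)"
        using x by (intro min) (auto intro!: convex_cone_scaleR[OF assms(2)])
      then show ?thesis
        using \<open>x \<noteq> 0\<close> x pos by (simp add: field_simps)
    qed
    then show ?thesis
      by (auto simp: bounded_iff)
  qed
  ultimately show ?thesis
    by (simp add: compact_eq_bounded_closed)
qed

section \<open>Simplices of maximal volume\<close>

lemma compact_matrices_with_rows_in:
  fixes K :: "(real^'n) set"
  assumes "compact K"
  shows "compact {V :: real^'n^'m. \<forall>i. V $h i \<in> K}"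
proof -
  have "closed {V :: real^'n^'m. \<forall>i. V $h i \<in> K}"
    by (rule closed_vector_box) (simp add: compact_imp_closed[OF assms])
  moreover obtain B where B: "\<And>x. x \<in> K \<Longrightarrow> norm x \<le> B"
    using compact_imp_bounded[OF assms] by (auto simp: bounded_iff)
  have "norm V \<le> real CARD('m) * B" if "\<forall>i. V $h i \<in> K" for V :: "real^'n^'m"
  proof -
    have "norm V \<le> (\<Sum>i\<in>UNIV. norm (V $h i))"
      by (simp add: norm_vec_def L2_set_le_sum)
    also have "\<dots> \<le> (\<Sum>i\<in>(UNIV :: 'm set). B)"
      using that B by (intro sum_mono) auto
    finally show ?thesis
      by simp
  qed
  then have "bounded {V :: real^'n^'m. \<forall>i. V $h i \<in> K}"
    by (auto simp: bounded_iff)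
  ultimately show ?thesis
    by (simp add: compact_eq_bounded_closed)
qed

text \<open>A basis chosen inside \<open>C\<close> serves as the rows. This ensures that the maximal
  determinant is not zero.\<close>

lemma nonsingular_rows_in_spanning_set:
  fixes C :: "(real^'d) set"
  assumes "span C = UNIV"
  obtains V :: "real^'d^'d" where "\<And>i. V $h i \<in> C" "Determinants.det V \<noteq> 0"
proof -
  obtain B where B: "B \<subseteq> C" "independent B" "C \<subseteq> span B"
    using maximal_independent_subset[of C] by auto
  have spanB: "span B = UNIV"
    using assms span_mono[OF B(3)] by (auto simp: span_span)
  have "card B = CARD('d)"
    using dim_span_eq_card_independent[OF B(2)] spanB by (simp add: dim_UNIV)
  moreover have "finite B"
    using B(2) by (rule independent_imp_finite)
  ultimately obtain f :: "'d \<Rightarrow> real^'d" where f: "bij_betw f UNIV B"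
    using finite_same_card_bij[of "UNIV :: 'd set" B] by auto
  define V :: "real^'d^'d" where "V = (\<chi> i. f i)"
  have "rows V = B"
    using f by (auto simp: rows_def row_def V_def bij_betw_def)
  then have "Determinants.det V \<noteq> 0"
    using spanB matrix_left_invertible_span_rows[of V] invertible_left_inverse[of V] invertible_det_nz[of V]
    by auto
  moreover have "V $h i \<in> C" for i
    using f B(1) by (auto simp: V_def bij_betw_def)
  ultimately show ?thesis
    using that by blast
qed

text \<open>Replacing row \<open>i\<close> of \<open>V\<close> by \<open>x\<close> multiplies the
  determinant by the coordinate of \<open>x\<close> at \<open>i\<close>. The new rows still lie in
  \<open>K\<close>, so maximality bounds this factor.\<close>

lemma coordinates_wrt_maximal_determinant:
  fixes K :: "(real^'d) set" and V W :: "real^'d^'d"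
  assumes V: "\<And>i. V $h i \<in> K" and "Determinants.det V \<noteq> 0"
    and max: "\<And>U :: real^'d^'d. (\<And>i. U $h i \<in> K) \<Longrightarrow>
      \<bar>Determinants.det U\<bar> \<le> \<bar>Determinants.det V\<bar>"
    and W: "W ** V = Finite_Cartesian_Product.mat 1" and "x \<in> K"
  shows "\<bar>(x v* W) $h i\<bar> \<le> 1"
proof -
  have row: "Finite_Cartesian_Product.row k V = V $h k" for k
    by (simp add: Finite_Cartesian_Product.row_def)
  have "x = (x v* W) v* V"
    by (simp add: vector_matrix_mul_assoc W)
  then have x: "(\<Sum>k\<in>UNIV. (x v* W) $h k *s Finite_Cartesian_Product.row k V) = x"
    by (simp add: row vector_matrix_mult_rows scalar_mult_eq_scaleR)
  have "Determinants.det (\<chi> k. if k = i then x else Finite_Cartesian_Product.row k V)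
      = (x v* W) $h i * Determinants.det V"
    using cramer_lemma_transpose[of i "x v* W" V] unfolding x .
  moreover have "\<bar>Determinants.det (\<chi> k. if k = i then x else Finite_Cartesian_Product.row k V)\<bar>
      \<le> \<bar>Determinants.det V\<bar>"
    using V \<open>x \<in> K\<close> by (intro max) (auto simp: row)
  ultimately show ?thesis
    using assms(2) by (simp add: abs_mult)
qed

section \<open>The scaled cone inside the cone over a maximal simplex\<close>

theorem theorem5p7:
  fixes C H :: "(real^'d) set"
  assumes "closed C" and "convex_cone C" and "salient C" and "interior C \<noteq> {}"
    and "subspace H" and "dim H + 1 = CARD('d)"
    and "H \<inter> C = {0}"
  shows "\<exists>u \<in> interior C. \<forall>s \<ge> 1.
           cone_max (scaled_cone (1 / (real CARD('d) + 1)) H u C) s \<subseteq> cone_min C s"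
proof -
  obtain a0 :: "real^'d" where a0: "a0 \<noteq> 0" "span H \<subseteq> {x. inner a0 x = 0}"
    using lowdim_subset_hyperplane[of H] assms(6) by auto
  \<comment> \<open>Equal dimensions turn the inclusion into equality, so \<open>inner a0\<close>
    vanishes on \<open>C\<close> only at 0.\<close>
  have H_eq: "H = {x. inner a0 x = 0}"
  proof (rule subspace_dim_equal[OF assms(5) subspace_hyperplane])
    show "H \<subseteq> {x. inner a0 x = 0}"
      using a0(2) span_superset by blast
    show "dim {x. inner a0 x = 0} \<le> dim H"
      using assms(6) by (simp add: dim_hyperplane[OF a0(1)])
  qed
  have sal: "C \<inter> uminus ` C = {0}"
    using assms(3) by (simp add: salient_def)
  obtain a where a: "a = a0 \<or> a = - a0" and pos: "\<And>x. x \<in> C \<Longrightarrow> x \<noteq> 0 \<Longrightarrow> 0 < inner a x"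
    using strictly_positive_on_cone[OF assms(2) sal, of a0] assms(7) H_eq by blast
  have Ha: "inner a y = 0" if "y \<in> H" for y
    using that a H_eq by auto
  define K where "K = {x \<in> C. inner a x = 1}"
  define M where "M = {V :: real^'d^'d. \<forall>i. V $h i \<in> K}"
  have "span C = UNIV"
    unfolding dim_eq_full[symmetric]
    using empty_interior_lowdim[of C] assms(4) dim_subset_UNIV[of C] by (metis order_le_less)
  then obtain V0 :: "real^'d^'d" where V0: "\<And>i. V0 $h i \<in> C" "Determinants.det V0 \<noteq> 0"
    using nonsingular_rows_in_spanning_set by blast
  have "V0 $h i \<noteq> 0" for i
    using V0(2) det_zero_row(1)[of i V0]
    by (auto simp: Finite_Cartesian_Product.row_def vec_eq_iff)
  then have posV0: "0 < inner a (V0 $h i)" for i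
    using V0(1) pos by blast
  \<comment> \<open>Rescaling each row by a positive factor moves it into the base and keeps the
    determinant nonzero.\<close>
  define V1 :: "real^'d^'d" where "V1 = (\<chi> i. (1 / inner a (V0 $h i)) *s V0 $h i)"
  have V1: "V1 \<in> M"
    using V0(1) posV0
    by (auto simp: M_def K_def V1_def scalar_mult_eq_scaleR less_imp_le less_imp_neq[symmetric]
        intro!: convex_cone_scaleR[OF assms(2)])
  have "Determinants.det V1 = (\<Prod>i\<in>UNIV. 1 / inner a (V0 $h i)) * Determinants.det V0"
    unfolding V1_def det_rows_mul by simp
  then have V1_det: "Determinants.det V1 \<noteq> 0"
    using V0(2) posV0 by (simp add: less_imp_neq[symmetric])
  have "compact M"
    unfolding M_def K_def
    by (intro compact_matrices_with_rows_in compact_cone_base assms pos)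
  moreover have "continuous_on M (\<lambda>V. \<bar>Determinants.det V\<bar>)"
    unfolding Determinants.det_def by (intro continuous_intros)
  ultimately obtain V where V: "V \<in> M"
    and max: "\<And>U. U \<in> M \<Longrightarrow> \<bar>Determinants.det U\<bar> \<le> \<bar>Determinants.det V\<bar>"
    using continuous_attains_sup[of M "\<lambda>V. \<bar>Determinants.det V\<bar>"] V1 by auto
  have V_det: "Determinants.det V \<noteq> 0"
    using max[OF V1] V1_det by auto
  then obtain W where W: "W ** V = Finite_Cartesian_Product.mat 1"
    "V ** W = Finite_Cartesian_Product.mat 1"
    using invertible_det_nz[of V] by (auto simp: invertible_def)
  have VK: "V $h i \<in> K" for i
    using V by (simp add: M_def)
  then have VC: "V $h i \<in> C" for i
    by (simp add: K_def)
  define S where "S = {x. \<forall>i. 0 \<le> (x v* W) $h i}"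
  have SC: "S \<subseteq> C"
    unfolding S_def by (rule simplicial_cone_subset[OF assms(2) VC W(1)])
  let ?d = "real CARD('d)"
  \<comment> \<open>Equal weights make \<open>u\<close> the barycenter of the rows of
    \<open>V\<close>.\<close>
  define e :: "real^'d" where "e = (\<chi> i. 1 / ?d)"
  define u where "u = e v* V"
  have uW: "(u v* W) $h i = 1 / ?d" for i
    by (simp add: u_def vector_matrix_mul_assoc W e_def)
  \<comment> \<open>All coordinates of \<open>u\<close> are positive, so this open subset of
    \<open>S\<close> is a neighborhood of \<open>u\<close> inside \<open>C\<close>.\<close>
  have "{x. \<forall>i. 0 < (x v* W) $h i} = (\<Inter>i. {x. 0 < (x v* W) $h i})"
    by auto
  moreover have "open {x. 0 < (x v* W) $h i}" for i
    unfolding vector_matrix_mult_def vec_lambda_beta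
    by (intro open_Collect_less continuous_intros)
  ultimately have "open {x. \<forall>i. 0 < (x v* W) $h i}"
    by (simp only: open_INT finite ball_UNIV simp_thms)
  then have u_int: "u \<in> interior C"
    using SC uW by (intro interiorI[of "{x. \<forall>i. 0 < (x v* W) $h i}"])
      (auto simp: S_def less_imp_le)
  have au: "inner a u = 1"
    using VK by (simp add: u_def vector_matrix_mult_rows inner_sum_right e_def K_def)
  have convS: "convex_cone S"
    unfolding convex_cone_iff S_def
    by (auto simp: vector_matrix_left_distrib scaleR_vector_matrix_assoc)
  have "scaled_cone (1 / (?d + 1)) H u C \<subseteq> S"
    unfolding scaled_cone_def
  proof (intro hull_minimal convS image_subsetI)
    fix x assume x: "x \<in> C \<inter> (+) u ` H"
    \<comment> \<open>The functional \<open>inner a\<close> is 1 at \<open>u\<close> and 0 on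
      \<open>H\<close>, so the slice of \<open>C\<close> through \<open>u\<close> lies in the base
      \<open>K\<close>.\<close>
    then have "x \<in> K"
      using Ha au by (auto simp: K_def inner_add_right)
    then have bound: "\<bar>(x v* W) $h i\<bar> \<le> 1" for i
      using VK max V_det W(1) by (intro coordinates_wrt_maximal_determinant[of V K]) (auto simp: M_def)
    let ?y = "u + (1 / (?d + 1)) *\<^sub>R (x - u)"
    have "0 \<le> (?y v* W) $h i" for i
    proof -
      \<comment> \<open>The worst case is coordinate -1, which is sent exactly to 0; this is where
        the factor \<open>1 / (?d + 1)\<close> comes from.\<close>
      have "(?y v* W) $h i = 1 / ?d + (1 / (?d + 1)) * ((x v* W) $h i - 1 / ?d)"
        by (simp add: vector_matrix_left_distrib scaleR_vector_matrix_assoc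
            vector_matrix_mult_diff_distrib uW)
      also have "\<dots> = (1 + (x v* W) $h i) / (?d + 1)"
        by (simp add: divide_simps) (simp add: algebra_simps)
      also have "\<dots> \<ge> 0"
        using bound[of i] by simp
      finally show ?thesis .
    qed
    then show "?y \<in> S"
      by (simp add: S_def)
  qed
  then have "cone_max (scaled_cone (1 / (?d + 1)) H u C) s \<subseteq> cone_min C s" for s
    using cone_max_mono cone_max_simplicial_cone_subset[OF VC W(1)] unfolding S_def by blast
  then show ?thesis
    using u_int by blast
qed

end
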